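(* Let $(X,d)$ be a metric space and let $K$ be a nonempty subset of $X$. Let $A,B,S,T:K\to K$ be selfmaps of $K$. Suppose there exist $\psi\in\Psi$ and $\phi\in\Phi$ such that for all $x,y\in K$: $$ \begin{aligned} \psi(d(Sx,Ty),d(Sx,Ty)) \leq \phi\Big(\max\big\{&\psi(d(Ax,By),d(Ax,Sx)),\ \psi(d(Ax,By),d(By,Ty)),\\ &\psi(d(Ax,Sx),d(By,Ty)),\ \psi(d(By,Ty),d(Ax,Sx)),\\ &\min\{\psi(d(By,Sx),d(Ax,Sx)),\ \psi(d(Ax,Ty),d(By,Ty))\},\\ &\min\{\psi(d(By,Sx),d(By,Ty)),\ \psi(d(Ax,Ty),d(Ax,Sx))\}\big\}\Big). \end{aligned} $$ Assume also that the pairs $(A,S)$ and $(B,T)$ are weakly compatible, that $\overline{T(K)}\subset A(K)$ and that $\overline{S(K)}\subset B(K)$. If at least one of $\overline{T(K)}$, $\overline{S(K)}$, $A(K)$, $B(K)$ is complete, then $A$, $B$, $S$ and $T$ have a unique common fixed point (that is, there is exactly one $z\in K$ with $Az=Bz=Sz=Tz=z$).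
   Context: $\mathbb{R}_+=[0,\infty)$. $\Psi$ denotes the set of all functions $\psi:\mathbb{R}_+\times\mathbb{R}_+\to\mathbb{R}_+$ such that (i) $\psi$ is continuous; (ii) $\psi$ is monotone increasing (i.e. nondecreasing) in each of its arguments; (iii) $\psi(0,0)=0$, and $\psi(t,0)=0$ implies $t=0$. $\Phi$ denotes the set of all functions $\phi:\mathbb{R}_+\to\mathbb{R}_+$ such that (i) $\phi$ is monotonically increasing (nondecreasing) and continuous; (ii) $0<\phi(t)<t$ for all $t>0$. Two selfmaps $F,G$ of a set are called weakly compatible if they commute at their coincidence points: whenever $Fx=Gx$, one has $FGx=GFx$. Here $\overline{E}$ denotes the closure of $E$ in $X$, and a subset is complete if it is a complete metric space under the restriction of $d$. *)

theory Defs
  imports "HOL-Analysis.Analysis"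
begin

text \<open>Functions on \<open>[0,\<infinity>)\<close> are represented by total functions on the reals; the conditions
  below only constrain their values on \<open>[0,\<infinity>)\<close>. Continuity of \<open>\<psi>\<close> is joint continuity.\<close>

definition Psi :: "(real \<Rightarrow> real \<Rightarrow> real) set" where
  "Psi = {\<psi>. (\<forall>s\<ge>0. \<forall>t\<ge>0. 0 \<le> \<psi> s t)
            \<and> continuous_on ({0..} \<times> {0..}) (\<lambda>(s, t). \<psi> s t)
            \<and> (\<forall>t\<ge>0. mono_on {0..} (\<lambda>s. \<psi> s t))
            \<and> (\<forall>s\<ge>0. mono_on {0..} (\<lambda>t. \<psi> s t))
            \<and> \<psi> 0 0 = 0
            \<and> (\<forall>t\<ge>0. \<psi> t 0 = 0 \<longrightarrow> t = 0)}"

definition Phi :: "(real \<Rightarrow> real) set" where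
  "Phi = {\<phi>. (\<forall>t\<ge>0. 0 \<le> \<phi> t)
            \<and> mono_on {0..} \<phi>
            \<and> continuous_on {0..} \<phi>
            \<and> (\<forall>t>0. 0 < \<phi> t \<and> \<phi> t < t)}"

definition weakly_compatible_on :: "'a set \<Rightarrow> ('a \<Rightarrow> 'a) \<Rightarrow> ('a \<Rightarrow> 'a) \<Rightarrow> bool" where
  "weakly_compatible_on K F G \<longleftrightarrow> (\<forall>x\<in>K. F x = G x \<longrightarrow> F (G x) = G (F x))"

end

theory Submission
  imports Defs
begin

text \<open>
  By monotonicity of \<open>\<psi>\<close>, the six-term maximum in the contractive condition is at most
  \<open>\<psi> E E\<close>, where \<open>E\<close> is the largest of \<open>d(Ax,By)\<close>, \<open>d(Ax,Sx)\<close>, \<open>d(By,Ty)\<close> and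
  \<open>min (d(By,Sx)) (d(Ax,Ty))\<close>. Hence with \<open>\<eta> t = \<psi> t t\<close> the condition reduces to
  \<open>\<eta>(d(Sx,Ty)) \<le> \<phi>(\<eta> E)\<close>, which is symmetric under exchanging \<open>(A,S)\<close> with \<open>(B,T)\<close>. Whenever
  both \<open>d(Sx,Ty)\<close> and \<open>E\<close> tend to the same limit, that limit is \<open>0\<close>. Applied along the sequence
  \<open>S x\<^sub>0 = B x\<^sub>1, T x\<^sub>1 = A x\<^sub>2, S x\<^sub>2 = B x\<^sub>3, \<dots>\<close> this shows first that consecutive distances tend
  to \<open>0\<close>, then that the sequence is Cauchy. Its limit \<open>z\<close> lies in \<open>A(K) \<inter> B(K)\<close>, is a coincidence
  value of both pairs and, by weak compatibility, a common fixed point.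
\<close>

section \<open>Reduction of the six-term condition to one variable\<close>

definition ciric_max :: "'a::metric_space \<Rightarrow> 'a \<Rightarrow> 'a \<Rightarrow> 'a \<Rightarrow> real" where
  "ciric_max a b s t =
    max (max (dist a b) (max (dist a s) (dist b t))) (min (dist b s) (dist a t))"

lemma ciric_max_nonneg: "0 \<le> ciric_max a b s t"
  by (simp add: ciric_max_def le_max_iff_disj)

lemma ciric_max_commute: "ciric_max b a t s = ciric_max a b s t"
  by (simp add: ciric_max_def dist_commute max.commute min.commute)

lemma tendsto_ciric_max:
  assumes "((\<lambda>n. dist (a n) (b n)) \<longlongrightarrow> lab) F" "((\<lambda>n. dist (a n) (s n)) \<longlongrightarrow> las) F"
    "((\<lambda>n. dist (b n) (t n)) \<longlongrightarrow> lbt) F" "((\<lambda>n. dist (b n) (s n)) \<longlongrightarrow> lbs) F"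
    "((\<lambda>n. dist (a n) (t n)) \<longlongrightarrow> lat) F"
  shows "((\<lambda>n. ciric_max (a n) (b n) (s n) (t n)) \<longlongrightarrow> max (max lab (max las lbt)) (min lbs lat)) F"
  unfolding ciric_max_def by (intro tendsto_max tendsto_min assms)

lemma Psi_mono:
  assumes "\<psi> \<in> Psi" "0 \<le> s" "s \<le> s'" "0 \<le> t" "t \<le> t'"
  shows "\<psi> s t \<le> \<psi> s' t'"
proof -
  have "mono_on {0..} (\<lambda>s. \<psi> s t)" "mono_on {0..} (\<psi> s')"
    using assms by (simp_all add: Psi_def)
  note mono = mono_onD[OF this(1)] mono_onD[OF this(2)]
  have "\<psi> s t \<le> \<psi> s' t"
    using mono(1)[of s s'] assms by simp
  also have "\<psi> s' t \<le> \<psi> s' t'"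
    using mono(2)[of t t'] assms by simp
  finally show ?thesis .
qed

text \<open>The four plain terms have both arguments at most \<open>ciric_max a b s t\<close>. At
  least one of the cross distances \<open>dist b s\<close>, \<open>dist a t\<close> is also below
  this bound. Each \<open>min\<close> has one branch for either cross distance, so the branch with
  the small one bounds it.\<close>

lemma Psi_contraction_imp_ciric:
  fixes a b s t :: "'a::metric_space"
  assumes psi: "\<psi> \<in> Psi" and phi: "\<phi> \<in> Phi"
    and le: "D \<le> \<phi> (Max
        {\<psi> (dist a b) (dist a s), \<psi> (dist a b) (dist b t),
         \<psi> (dist a s) (dist b t), \<psi> (dist b t) (dist a s),
         min (\<psi> (dist b s) (dist a s)) (\<psi> (dist a t) (dist b t)),
         min (\<psi> (dist b s) (dist b t)) (\<psi> (dist a t) (dist a s))})" (is "D \<le> \<phi> (Max ?M)")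
  shows "D \<le> \<phi> (\<psi> (ciric_max a b s t) (ciric_max a b s t))"
proof -
  let ?E = "ciric_max a b s t"
  have E: "dist a b \<le> ?E" "dist a s \<le> ?E" "dist b t \<le> ?E"
    by (simp_all add: ciric_max_def le_max_iff_disj)
  have "dist b s \<le> ?E \<or> dist a t \<le> ?E"
    using linear[of "dist b s" "dist a t"] unfolding ciric_max_def le_max_iff_disj by auto
  moreover have mono: "\<psi> p q \<le> \<psi> ?E ?E" if "0 \<le> p" "p \<le> ?E" "0 \<le> q" "q \<le> ?E" for p q
    using Psi_mono[OF psi] that by blast
  ultimately have min_le: "min (\<psi> (dist b s) p) (\<psi> (dist a t) q) \<le> \<psi> ?E ?E"
    if "0 \<le> p" "p \<le> ?E" "0 \<le> q" "q \<le> ?E" for p q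
    using that by (metis min_le_iff_disj zero_le_dist)
  have le_E: "Max ?M \<le> \<psi> ?E ?E"
    by (rule Max.boundedI)
      (simp, simp, safe intro!: mono min_le E zero_le_dist)
  \<comment> \<open>Monotonicity of \<open>\<phi>\<close> is given only on \<open>{0..}\<close>, so
    both arguments have to be placed there first.\<close>
  have Max_nonneg: "0 \<le> Max ?M"
  proof -
    have "0 \<le> \<psi> (dist a b) (dist a s)"
      using psi by (simp add: Psi_def)
    also have "\<dots> \<le> Max ?M" by (rule Max_ge) simp_all
    finally show ?thesis .
  qed
  have nonneg: "Max ?M \<in> {0..}" "\<psi> ?E ?E \<in> {0..}"
    unfolding atLeast_iff by (rule Max_nonneg, rule order_trans[OF Max_nonneg le_E])
  have "mono_on {0..} \<phi>"
    using phi by (simp add: Phi_def)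
  from mono_onD[OF this nonneg le_E] le show ?thesis by (rule order_trans[rotated])
qed

section \<open>One-variable contractions and the failure of the Cauchy property\<close>

locale phi_contraction =
  fixes \<eta> \<phi> :: "real \<Rightarrow> real"
  assumes eta_nonneg: "0 \<le> t \<Longrightarrow> 0 \<le> \<eta> t"
    and eta_eq_0: "0 \<le> t \<Longrightarrow> \<eta> t = 0 \<Longrightarrow> t = 0"
    and eta_continuous: "continuous_on {0..} \<eta>"
    and phi: "\<phi> \<in> Phi"
begin

lemma eq_0I:
  assumes "\<eta> D \<le> \<phi> (\<eta> D)" "0 \<le> D"
  shows "D = 0"
proof (rule ccontr)
  assume "D \<noteq> 0"
  then have "0 < \<eta> D"
    using assms eta_nonneg[of D] eta_eq_0[of D] by fastforce
  then show False
    using assms phi by (force simp: Phi_def)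
qed

text \<open>Continuity of \<open>\<eta>\<close> and \<open>\<phi>\<close> carries the inequality to
  the limit as \<open>\<eta> L \<le> \<phi> (\<eta> L)\<close>, which \<open>\<phi> t < t\<close>
  allows only for \<open>\<eta> L = 0\<close>.\<close>

lemma limit_eq_0:
  fixes D E :: "nat \<Rightarrow> real"
  assumes le: "\<And>n. \<eta> (D n) \<le> \<phi> (\<eta> (E n))"
    and nonneg: "\<And>n. 0 \<le> D n" "\<And>n. 0 \<le> E n"
    and D: "D \<longlonglongrightarrow> L" and E: "E \<longlonglongrightarrow> L"
  shows "L = 0"
proof -
  have L: "0 \<le> L"
    using D nonneg(1) by (intro LIMSEQ_le_const) auto
  have etaD: "(\<lambda>n. \<eta> (D n)) \<longlonglongrightarrow> \<eta> L"
    using nonneg L by (intro continuous_on_tendsto_compose[OF eta_continuous D]) auto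
  have etaE: "(\<lambda>n. \<eta> (E n)) \<longlonglongrightarrow> \<eta> L"
    using nonneg L by (intro continuous_on_tendsto_compose[OF eta_continuous E]) auto
  have "continuous_on {0..} \<phi>"
    using phi by (simp add: Phi_def)
  then have "(\<lambda>n. \<phi> (\<eta> (E n))) \<longlonglongrightarrow> \<phi> (\<eta> L)"
    using nonneg L eta_nonneg by (intro continuous_on_tendsto_compose[OF _ etaE]) auto
  with etaD have "\<eta> L \<le> \<phi> (\<eta> L)"
    using le by (intro LIMSEQ_le) auto
  then show ?thesis using L by (rule eq_0I)
qed

end

text \<open>The contraction compares a value of \<open>S\<close> with a value of \<open>T\<close>,
  hence only indices of opposite parity. The usual far-apart pairs can be given that parity by
  shifting one index, since a single step becomes negligible.\<close>

lemma not_Cauchy_odd_pair: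
  fixes y :: "nat \<Rightarrow> 'a::metric_space"
  assumes d: "(\<lambda>n. dist (y n) (y (Suc n))) \<longlonglongrightarrow> 0" and nC: "\<not> Cauchy y"
  obtains e p q where "0 < e" "filterlim p at_top sequentially" "filterlim q at_top sequentially"
    "\<And>k. odd (p k + q k)" "(\<lambda>k. dist (y (p k)) (y (q k))) \<longlonglongrightarrow> e"
proof -
  obtain e where e: "0 < e" and far: "\<And>N. \<exists>n\<ge>N. \<exists>m>n. e \<le> dist (y n) (y m)"
    using nC unfolding Cauchy_altdef by (force simp: not_less)
  have pair: "\<exists>p\<ge>N. \<exists>q\<ge>N. odd (p + q) \<and> \<bar>dist (y p) (y q) - e\<bar> < \<delta>" if "0 < \<delta>" for N \<delta>
  proof -
    \<comment> \<open>Half of \<open>\<delta>\<close> per step leaves room for two steps: the one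
      into \<open>m\<close> and the parity shift to \<open>Suc m\<close>.\<close>
    have "\<forall>\<^sub>F n in sequentially. dist (y n) (y (Suc n)) < min (\<delta> / 2) e"
      using order_tendstoD(2)[OF d, of "min (\<delta> / 2) e"] that e by simp
    then obtain M where M: "\<And>n. n \<ge> M \<Longrightarrow> dist (y n) (y (Suc n)) < min (\<delta> / 2) e"
      unfolding eventually_sequentially by auto
    obtain n where n: "n \<ge> max M N" and far_n: "\<exists>m. m > n \<and> e \<le> dist (y n) (y m)"
      using far by blast
    \<comment> \<open>By minimality the predecessor of \<open>m\<close> is closer than
      \<open>e\<close> to \<open>y n\<close> (it may be \<open>n\<close> itself), so
      \<open>dist (y n) (y m)\<close> exceeds \<open>e\<close> by less than one step.\<close>
    define m where "m = (LEAST m. m > n \<and> e \<le> dist (y n) (y m))"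
    have m: "m > n" "e \<le> dist (y n) (y m)"
      using LeastI_ex[OF far_n] by (simp_all add: m_def)
    have least: "dist (y n) (y k) < e" if "n < k" "k < m" for k
      using not_less_Least[of k "\<lambda>m. m > n \<and> e \<le> dist (y n) (y m)"] that by (simp add: m_def)
    obtain k where k: "m = Suc k"
      using m(1) by (cases m) auto
    have "dist (y n) (y k) < e"
      using least[of k] m(1) k e by (cases "k = n") auto
    moreover have "dist (y n) (y m) \<le> dist (y n) (y k) + dist (y k) (y (Suc k))"
      unfolding k by (rule dist_triangle)
    moreover have "dist (y k) (y (Suc k)) < \<delta> / 2"
      using M[of k] n m(1) k by simp
    ultimately have close: "\<bar>dist (y n) (y m) - e\<bar> < \<delta> / 2"
      using m(2) by linarith
    have "\<bar>dist (y n) (y (Suc m)) - dist (y n) (y m)\<bar> \<le> dist (y m) (y (Suc m))"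
      by (metis abs_dist_diff_le dist_commute)
    moreover have "dist (y m) (y (Suc m)) < \<delta> / 2"
      using M[of m] n m(1) by simp
    ultimately have close': "\<bar>dist (y n) (y (Suc m)) - e\<bar> < \<delta>"
      using close by linarith
    show ?thesis
    proof (cases "odd (n + m)")
      case True
      then show ?thesis using close n m(1) that by (intro exI[of _ n] exI[of _ m] conjI) auto
    next
      case False
      then show ?thesis using close' n m(1) by (intro exI[of _ n] exI[of _ "Suc m"] conjI) auto
    qed
  qed
  have "\<forall>k. \<exists>p q. k \<le> p \<and> k \<le> q \<and> odd (p + q) \<and> \<bar>dist (y p) (y q) - e\<bar> < inverse (real (Suc k))"
  proof
    fix k
    have "0 < inverse (real (Suc k))" by simp
    from pair[OF this, of k]
    show "\<exists>p q. k \<le> p \<and> k \<le> q \<and> odd (p + q) \<and> \<bar>dist (y p) (y q) - e\<bar> < inverse (real (Suc k))"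
      by blast
  qed
  then obtain p q where pq: "\<And>k. k \<le> p k" "\<And>k. k \<le> q k" "\<And>k. odd (p k + q k)"
      "\<And>k. \<bar>dist (y (p k)) (y (q k)) - e\<bar> < inverse (real (Suc k))"
    by metis
  show thesis
  proof (rule that[OF e])
    show "filterlim p at_top sequentially" "filterlim q at_top sequentially"
      by (rule filterlim_at_top_mono[OF filterlim_ident], simp add: pq)+
    show "odd (p k + q k)" for k by (rule pq)
    have "(\<lambda>k. dist (y (p k)) (y (q k)) - e) \<longlonglongrightarrow> 0"
      by (rule Lim_null_comparison[OF _ LIMSEQ_inverse_real_of_nat])
        (use pq(4) in \<open>auto intro!: always_eventually less_imp_le\<close>)
    then show "(\<lambda>k. dist (y (p k)) (y (q k))) \<longlonglongrightarrow> e"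
      by (simp add: LIM_zero_iff)
  qed
qed

lemma tendsto_dist_perturb:
  fixes a a' b b' :: "'b \<Rightarrow> 'a::metric_space"
  assumes "((\<lambda>n. dist (a n) (b n)) \<longlongrightarrow> l) F"
    and "((\<lambda>n. dist (a n) (a' n)) \<longlongrightarrow> 0) F" "((\<lambda>n. dist (b n) (b' n)) \<longlongrightarrow> 0) F"
  shows "((\<lambda>n. dist (a' n) (b' n)) \<longlongrightarrow> l) F"
proof -
  have "\<bar>dist (a' n) (b' n) - dist (a n) (b n)\<bar> \<le> dist (a n) (a' n) + dist (b n) (b' n)" for n
    using dist_triangle[of "a' n" "b' n" "a n"] dist_triangle[of "a n" "b' n" "b n"]
      dist_triangle[of "a n" "b n" "a' n"] dist_triangle[of "a' n" "b n" "b' n"]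
      dist_commute[of "a n" "a' n"] dist_commute[of "b n" "b' n"]
    by linarith
  then have "\<forall>\<^sub>F n in F. norm (dist (a' n) (b' n) - dist (a n) (b n))
      \<le> dist (a n) (a' n) + dist (b n) (b' n)"
    by simp
  moreover have "((\<lambda>n. dist (a n) (a' n) + dist (b n) (b' n)) \<longlongrightarrow> 0) F"
    using tendsto_add[OF assms(2,3)] by simp
  ultimately have "((\<lambda>n. dist (a' n) (b' n) - dist (a n) (b n)) \<longlongrightarrow> 0) F"
    by (rule Lim_null_comparison)
  from tendsto_add[OF this assms(1)] show ?thesis by simp
qed

section \<open>Convergence arguments for the alternating sequence\<close>

context phi_contraction
begin

lemma consecutive_dist_tendsto_0:
  fixes y :: "nat \<Rightarrow> 'a::metric_space"
  assumes le: "\<And>p q. odd (p + q) \<Longrightarrow>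
      \<eta> (dist (y (Suc p)) (y (Suc q))) \<le> \<phi> (\<eta> (ciric_max (y p) (y q) (y (Suc p)) (y (Suc q))))"
  shows "(\<lambda>n. dist (y n) (y (Suc n))) \<longlonglongrightarrow> 0"
proof -
  define d where "d n = dist (y n) (y (Suc n))" for n
  \<comment> \<open>The second and third arguments coincide, so the cross term vanishes; this is
    where taking the minimum of the cross distances matters.\<close>
  have E: "ciric_max (y n) (y (Suc n)) (y (Suc n)) (y (Suc (Suc n))) = max (d n) (d (Suc n))" for n
    unfolding ciric_max_def d_def by (auto simp: max_def)
  have step: "\<eta> (d (Suc n)) \<le> \<phi> (\<eta> (max (d n) (d (Suc n))))" for n
    using le[of n "Suc n"] by (simp add: E flip: d_def)
  have nonneg: "0 \<le> d n" for n by (simp add: d_def)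
  \<comment> \<open>Otherwise the maximum in \<open>step\<close> is \<open>d (Suc n)\<close>, which
    \<open>eq_0I\<close> forces to be 0, below \<open>d n\<close>.\<close>
  have "d (Suc n) \<le> d n" for n
  proof (rule ccontr)
    assume "\<not> d (Suc n) \<le> d n"
    with step[of n] nonneg[of n] eq_0I[of "d (Suc n)"] show False by (auto simp: max_def)
  qed
  then have dec: "decseq d" by (simp add: decseq_Suc_iff)
  then obtain L where L: "d \<longlonglongrightarrow> L"
    using decseq_convergent[of d 0] nonneg by metis
  have max: "max (d n) (d (Suc n)) = d n" for n
    using dec by (simp add: decseq_Suc_iff max_absorb1)
  have "L = 0"
    using limit_eq_0[of "\<lambda>n. d (Suc n)" d L] step L LIMSEQ_Suc[OF L] nonneg by (simp add: max)
  with L show ?thesis by (simp add: d_def[abs_def])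
qed

text \<open>Along the pairs from \<open>not_Cauchy_odd_pair\<close>, moving either index by one
  keeps the limit \<open>e\<close>. So the left distance and \<open>ciric_max\<close> both tend to
  \<open>e\<close>, and \<open>limit_eq_0\<close> contradicts \<open>0 < e\<close>.\<close>

lemma Cauchy_alternating:
  fixes y :: "nat \<Rightarrow> 'a::metric_space"
  assumes le: "\<And>p q. odd (p + q) \<Longrightarrow>
      \<eta> (dist (y (Suc p)) (y (Suc q))) \<le> \<phi> (\<eta> (ciric_max (y p) (y q) (y (Suc p)) (y (Suc q))))"
  shows "Cauchy y"
proof (rule ccontr)
  assume "\<not> Cauchy y"
  have d: "(\<lambda>n. dist (y n) (y (Suc n))) \<longlonglongrightarrow> 0"
    by (rule consecutive_dist_tendsto_0[of y]) (erule le)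
  show False
  proof (rule not_Cauchy_odd_pair[OF d \<open>\<not> Cauchy y\<close>])
    fix e p q
    assume e: "0 < e" and p: "filterlim p at_top sequentially"
      and q: "filterlim q at_top sequentially" and odd: "\<And>k. odd (p k + q k)"
      and lim: "(\<lambda>k. dist (y (p k)) (y (q k))) \<longlonglongrightarrow> e"
    have dp: "(\<lambda>k. dist (y (p k)) (y (Suc (p k)))) \<longlonglongrightarrow> 0"
      and dq: "(\<lambda>k. dist (y (q k)) (y (Suc (q k)))) \<longlonglongrightarrow> 0"
      by (rule filterlim_compose[OF d p], rule filterlim_compose[OF d q])
    have D: "(\<lambda>k. dist (y (Suc (p k))) (y (Suc (q k)))) \<longlonglongrightarrow> e"
      by (rule tendsto_dist_perturb[OF lim dp dq])
    have qSp: "(\<lambda>k. dist (y (q k)) (y (Suc (p k)))) \<longlonglongrightarrow> e"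
      using tendsto_dist_perturb[OF lim dp, of "\<lambda>k. y (q k)"] by (simp add: dist_commute)
    have pSq: "(\<lambda>k. dist (y (p k)) (y (Suc (q k)))) \<longlonglongrightarrow> e"
      using tendsto_dist_perturb[OF lim _ dq, of "\<lambda>k. y (p k)"] by simp
    have "(\<lambda>k. ciric_max (y (p k)) (y (q k)) (y (Suc (p k))) (y (Suc (q k)))) \<longlonglongrightarrow> e"
      using tendsto_ciric_max[OF lim dp dq qSp pSq] e by simp
    then have "e = 0"
      by (rule limit_eq_0[OF _ _ _ D, rotated -1]) (intro le odd ciric_max_nonneg zero_le_dist)+
    with e show False by simp
  qed
qed

text \<open>Every distance in \<open>ciric_max\<close> not involving \<open>s\<close> tends to 0, so
  it has the same limit \<open>dist s z\<close> as the left side. Constant sequences are also a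
  useful case.\<close>

lemma coincidence_value_of_limit:
  fixes b t :: "nat \<Rightarrow> 'a::metric_space"
  assumes le: "\<And>n. \<eta> (dist s (t n)) \<le> \<phi> (\<eta> (ciric_max z (b n) s (t n)))"
    and b: "b \<longlonglongrightarrow> z" and t: "t \<longlonglongrightarrow> z"
  shows "s = z"
proof -
  have "(\<lambda>n. ciric_max z (b n) s (t n)) \<longlonglongrightarrow>
      max (max (dist z z) (max (dist z s) (dist z z))) (min (dist z s) (dist z z))"
    by (intro tendsto_ciric_max tendsto_dist tendsto_const b t)
  then have "(\<lambda>n. ciric_max z (b n) s (t n)) \<longlonglongrightarrow> dist s z"
    by (simp add: dist_commute)
  moreover have "(\<lambda>n. dist s (t n)) \<longlonglongrightarrow> dist s z"
    by (intro tendsto_dist tendsto_const t)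
  ultimately have "dist s z = 0"
    by (intro limit_eq_0[of "\<lambda>n. dist s (t n)" "\<lambda>n. ciric_max z (b n) s (t n)"])
      (simp_all add: le ciric_max_nonneg)
  then show ?thesis by simp
qed

end

section \<open>Instantiation and the common fixed point\<close>

lemma phi_contraction_Psi:
  assumes psi: "\<psi> \<in> Psi" and "\<phi> \<in> Phi"
  shows "phi_contraction (\<lambda>t. \<psi> t t) \<phi>"
proof
  show "0 \<le> \<psi> t t" if "0 \<le> t" for t
    using psi that by (simp add: Psi_def)
  show "t = 0" if "0 \<le> t" "\<psi> t t = 0" for t
  proof -
    \<comment> \<open>Monotonicity moves the zero from the diagonal to the axis, where membership in
      \<open>Psi\<close> gives information.\<close>
    have "\<psi> t 0 \<le> 0" using Psi_mono[OF psi, of t t 0 t] that by simp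
    moreover have "0 \<le> \<psi> t 0" using psi that(1) by (simp add: Psi_def)
    ultimately have "\<psi> t 0 = 0" by simp
    then show ?thesis using psi that(1) by (simp add: Psi_def)
  qed
  have "continuous_on ({0..} \<times> {0..}) (\<lambda>(s, t). \<psi> s t)"
    using psi by (simp add: Psi_def)
  then have "continuous_on {0..} (\<lambda>t. (\<lambda>(s, t). \<psi> s t) (t, t))"
    by (rule continuous_on_compose2) (auto intro!: continuous_intros)
  then show "continuous_on {0..} (\<lambda>t. \<psi> t t)" by simp
qed fact

text \<open>Needed because the complete set is only known to contain the even-indexed or the
  odd-indexed terms.\<close>

lemma Cauchy_convergent_if_frequently_in_complete:
  fixes y :: "nat \<Rightarrow> 'a::metric_space"
  assumes "Cauchy y" "complete C" "strict_mono (r :: nat \<Rightarrow> nat)" "\<And>n. y (r n) \<in> C"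
  shows "convergent y"
proof -
  have "Cauchy (y \<circ> r)" using assms(1,3) by (rule Cauchy_subseq_Cauchy)
  then obtain l where "(y \<circ> r) \<longlonglongrightarrow> l"
    using assms(2,4) unfolding complete_def by (metis comp_apply)
  then show ?thesis
    using Cauchy_converges_subseq[OF assms(1,3)] by (auto simp: convergent_def)
qed

lemma alternating_sequence:
  assumes "x0 \<in> K" and S: "S ` K \<subseteq> B ` K" and T: "T ` K \<subseteq> A ` K"
  shows "\<exists>x. \<forall>n. x n \<in> K \<and>
    ((even n \<longrightarrow> B (x (Suc n)) = S (x n)) \<and> (odd n \<longrightarrow> A (x (Suc n)) = T (x n)))"
proof -
  have "\<exists>w'\<in>K. (even n \<longrightarrow> B w' = S w) \<and> (odd n \<longrightarrow> A w' = T w)" if "w \<in> K" for w and n :: nat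
    using S T that by (cases "even n") (force simp: image_subset_iff image_iff)+
  then show ?thesis
    using \<open>x0 \<in> K\<close> by (intro dependent_nat_choice) blast+
qed

theorem theorem2p1:
  fixes K :: "'a::metric_space set"
    and A B S T :: "'a \<Rightarrow> 'a"
    and \<psi> :: "real \<Rightarrow> real \<Rightarrow> real"
    and \<phi> :: "real \<Rightarrow> real"
  assumes "K \<noteq> {}"
    and "A \<in> K \<rightarrow> K" and "B \<in> K \<rightarrow> K" and "S \<in> K \<rightarrow> K" and "T \<in> K \<rightarrow> K"
    and "\<psi> \<in> Psi" and "\<phi> \<in> Phi"
    and "\<And>x y. x \<in> K \<Longrightarrow> y \<in> K \<Longrightarrow>
      \<psi> (dist (S x) (T y)) (dist (S x) (T y)) \<le> \<phi> (Max
        {\<psi> (dist (A x) (B y)) (dist (A x) (S x)),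
         \<psi> (dist (A x) (B y)) (dist (B y) (T y)),
         \<psi> (dist (A x) (S x)) (dist (B y) (T y)),
         \<psi> (dist (B y) (T y)) (dist (A x) (S x)),
         min (\<psi> (dist (B y) (S x)) (dist (A x) (S x)))
             (\<psi> (dist (A x) (T y)) (dist (B y) (T y))),
         min (\<psi> (dist (B y) (S x)) (dist (B y) (T y)))
             (\<psi> (dist (A x) (T y)) (dist (A x) (S x)))})"
    and "weakly_compatible_on K A S" and "weakly_compatible_on K B T"
    and "closure (T ` K) \<subseteq> A ` K" and "closure (S ` K) \<subseteq> B ` K"
    and "complete (closure (T ` K)) \<or> complete (closure (S ` K))
         \<or> complete (A ` K) \<or> complete (B ` K)"
  shows "\<exists>!z. z \<in> K \<and> A z = z \<and> B z = z \<and> S z = z \<and> T z = z"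
proof -
  define \<eta> where "\<eta> t = \<psi> t t" for t
  interpret phi_contraction \<eta> \<phi>
    unfolding \<eta>_def[abs_def] by (rule phi_contraction_Psi) fact+
  have le: "\<eta> (dist (S x) (T y)) \<le> \<phi> (\<eta> (ciric_max (A x) (B y) (S x) (T y)))"
    if "x \<in> K" "y \<in> K" for x y
    unfolding \<eta>_def using assms(8)[OF that] by (rule Psi_contraction_imp_ciric[OF assms(6,7)])
  have TA: "closure (T ` K) \<subseteq> A ` K" and SB: "closure (S ` K) \<subseteq> B ` K" by fact+
  obtain x0 where "x0 \<in> K" using \<open>K \<noteq> {}\<close> by blast
  moreover have "S ` K \<subseteq> B ` K" "T ` K \<subseteq> A ` K"
    using TA SB closure_subset by blast+
  ultimately have "\<exists>x. \<forall>n. x n \<in> K \<and>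
      ((even n \<longrightarrow> B (x (Suc n)) = S (x n)) \<and> (odd n \<longrightarrow> A (x (Suc n)) = T (x n)))"
    by (rule alternating_sequence)
  then obtain x where x: "\<And>n. x n \<in> K"
    and Bx: "\<And>n. even n \<Longrightarrow> B (x (Suc n)) = S (x n)"
    and Ax: "\<And>n. odd n \<Longrightarrow> A (x (Suc n)) = T (x n)"
    by blast
  \<comment> \<open>Thus \<open>y n\<close> is also \<open>B (x (Suc n))\<close> for even
    \<open>n\<close> and \<open>A (x (Suc n))\<close> for odd \<open>n\<close>. The condition at
    \<open>x (Suc p)\<close>, \<open>x (Suc q)\<close> with \<open>p\<close> odd and
    \<open>q\<close> even involves only terms of \<open>y\<close>.\<close>
  define y where "y n = (if even n then S (x n) else T (x n))" for n
  have y_le: "\<eta> (dist (y (Suc p)) (y (Suc q))) \<le> \<phi> (\<eta> (ciric_max (y p) (y q) (y (Suc p)) (y (Suc q))))"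
    if "odd p" "even q" for p q
    using le[OF x x, of "Suc p" "Suc q"] that by (simp add: y_def Ax Bx)
  have "Cauchy y"
  proof (rule Cauchy_alternating)
    fix p q :: nat
    assume "odd (p + q)"
    then consider "odd p" "even q" | "odd q" "even p" by auto
    then show "\<eta> (dist (y (Suc p)) (y (Suc q)))
        \<le> \<phi> (\<eta> (ciric_max (y p) (y q) (y (Suc p)) (y (Suc q))))"
    proof cases
      case 1
      then show ?thesis by (rule y_le)
    next
      \<comment> \<open>Both sides are unchanged when \<open>p\<close> and \<open>q\<close> are
        exchanged.\<close>
      case 2
      from y_le[OF this] show ?thesis
        by (simp add: dist_commute ciric_max_commute[of "y q" "y p"])
    qed
  qed
  have y_even: "y (2 * n) \<in> S ` K" and y_odd: "y (Suc (2 * n)) \<in> T ` K" for n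
    using x by (auto simp: y_def)
  have "convergent y"
  proof -
    \<comment> \<open>Each of the four candidate sets contains \<open>S\<close> K\<open>or\<close>T
      \<open>K\<close>, so two cases suffice.\<close>
    have "complete C \<Longrightarrow> S ` K \<subseteq> C \<Longrightarrow> convergent y" for C
      using y_even \<open>Cauchy y\<close>
      by (intro Cauchy_convergent_if_frequently_in_complete[where r = "\<lambda>n. 2 * n" and C = C])
        (auto simp: strict_mono_def)
    moreover have "complete C \<Longrightarrow> T ` K \<subseteq> C \<Longrightarrow> convergent y" for C
      using y_odd \<open>Cauchy y\<close>
      by (intro Cauchy_convergent_if_frequently_in_complete[where r = "\<lambda>n. Suc (2 * n)" and C = C])
        (auto simp: strict_mono_def)
    ultimately show ?thesis
      using assms(13) \<open>S ` K \<subseteq> B ` K\<close> \<open>T ` K \<subseteq> A ` K\<close> closure_subset by metis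
  qed
  then obtain z where z: "y \<longlonglongrightarrow> z" by (auto simp: convergent_def)
  have even: "(\<lambda>n. y (2 * n)) \<longlonglongrightarrow> z" and odd: "(\<lambda>n. y (Suc (2 * n))) \<longlonglongrightarrow> z"
    using LIMSEQ_subseq_LIMSEQ[OF z, of "\<lambda>n. 2 * n"] LIMSEQ_subseq_LIMSEQ[OF z, of "\<lambda>n. Suc (2 * n)"]
    by (auto simp: strict_mono_def o_def)
  \<comment> \<open>Whichever set was complete, \<open>z\<close> is a limit of both the even and the
    odd terms.\<close>
  have "z \<in> closure (S ` K)" "z \<in> closure (T ` K)"
    using y_even even y_odd odd by (meson closure_sequential)+
  with TA SB have "z \<in> A ` K" "z \<in> B ` K"
    by (meson subsetD)+
  then obtain u v where u: "u \<in> K" "A u = z" and v: "v \<in> K" "B v = z"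
    by (metis imageE)
  have "S u = z"
  proof (rule coincidence_value_of_limit[OF _ even odd])
    show "\<eta> (dist (S u) (y (Suc (2 * n)))) \<le> \<phi> (\<eta> (ciric_max z (y (2 * n)) (S u) (y (Suc (2 * n)))))" for n
      using le[OF u(1) x, of "Suc (2 * n)"] by (simp add: u y_def Bx)
  qed
  have "T v = z"
  \<comment> \<open>With \<open>A u = S u = z\<close> already known, constant sequences suffice, and
    \<open>T v\<close> takes the role of \<open>s\<close>.\<close>
  proof (rule coincidence_value_of_limit[OF _ tendsto_const tendsto_const])
    show "\<eta> (dist (T v) z) \<le> \<phi> (\<eta> (ciric_max z z (T v) z))"
      using le[OF u(1) v(1)]
      by (simp add: u v \<open>S u = z\<close> dist_commute ciric_max_commute[of z z z])
  qed
  have zK: "z \<in> K" using u \<open>A \<in> K \<rightarrow> K\<close> by blast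
  have Az: "A z = S z"
    using \<open>weakly_compatible_on K A S\<close> u \<open>S u = z\<close> unfolding weakly_compatible_on_def by metis
  have Bz: "B z = T z"
    using \<open>weakly_compatible_on K B T\<close> v \<open>T v = z\<close> unfolding weakly_compatible_on_def by metis
  \<comment> \<open>At coincidence points \<open>ciric_max\<close> collapses to
    \<open>dist (S p) (T q)\<close>, so \<open>eq_0I\<close> applies. This yields both that
    \<open>z\<close> is fixed and that it is unique.\<close>
  have eq: "S p = T q" if "p \<in> K" "q \<in> K" "A p = S p" "B q = T q" for p q
    using le[OF that(1,2)] eq_0I[of "dist (S p) (T q)"] that(3,4)
    by (simp add: ciric_max_def dist_commute)
  show ?thesis
  proof (rule ex1I)
    show "z \<in> K \<and> A z = z \<and> B z = z \<and> S z = z \<and> T z = z"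
      using eq[OF zK v(1)] eq[OF u(1) zK] Az Bz u v zK \<open>S u = z\<close> \<open>T v = z\<close> by simp
    show "w = z" if "w \<in> K \<and> A w = w \<and> B w = w \<and> S w = w \<and> T w = w" for w
      using eq[of w v] that v \<open>T v = z\<close> by simp
  qed
qed

end
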